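(* If $A$ contains at least two atoms, then the axioms of $\mathrm{EqFSCL}^-$ are independent: for each equation $e\in\mathrm{EqFSCL}^-$, $e$ is not derivable in equational logic from $\mathrm{EqFSCL}^-\setminus\{e\}$ (equivalently, there is a $\Sigma_{SCL}(A)$-algebra satisfying all of $\mathrm{EqFSCL}^-\setminus\{e\}$ but not $e$).
   Context: The signature $\Sigma_{SCL}(A)$, for a set $A$ of atoms, has constants $\mathsf T,\mathsf F$, each $a\in A$ as a constant, unary $\neg$, binary $\land^\circ$ and $\lor^\circ$. $\mathrm{EqFSCL}^-$ consists of the eight equations (variables $x,y,z$): (F2) $x\lor^\circ y=\neg(\neg x\land^\circ\neg y)$; (F4) $\mathsf T\land^\circ x=x$; (F5) $x\lor^\circ\mathsf F=x$; (F6) $\mathsf F\land^\circ x=\mathsf F$; (F7) $(x\land^\circ y)\land^\circ z=x\land^\circ(y\land^\circ z)$; (F8) $\neg x\land^\circ\mathsf F=x\land^\circ\mathsf F$; (F9) $(x\land^\circ\mathsf F)\lor^\circ y=(x\lor^\circ\mathsf T)\land^\circ y$; (F10) $(x\land^\circ y)\lor^\circ(z\land^\circ\mathsf F)=(x\lor^\circ(z\land^\circ\mathsf F))\land^\circ(y\lor^\circ(z\land^\circ\mathsf F))$. *)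

theory Defs
  imports Main
begin

datatype 'a sclterm =
    Var nat
  | Tr
  | Fa
  | Atom 'a
  | Neg "'a sclterm"
  | LAnd "'a sclterm" "'a sclterm"
  | LOr "'a sclterm" "'a sclterm"

primrec subst :: "(nat \<Rightarrow> 'a sclterm) \<Rightarrow> 'a sclterm \<Rightarrow> 'a sclterm" where
  "subst \<sigma> (Var n) = \<sigma> n"
| "subst \<sigma> Tr = Tr"
| "subst \<sigma> Fa = Fa"
| "subst \<sigma> (Atom a) = Atom a"
| "subst \<sigma> (Neg t) = Neg (subst \<sigma> t)"
| "subst \<sigma> (LAnd s t) = LAnd (subst \<sigma> s) (subst \<sigma> t)"
| "subst \<sigma> (LOr s t) = LOr (subst \<sigma> s) (subst \<sigma> t)"

inductive derivable :: "('a sclterm \<times> 'a sclterm) set \<Rightarrow> 'a sclterm \<Rightarrow> 'a sclterm \<Rightarrow> bool"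
  for E where
  ax: "(s, t) \<in> E \<Longrightarrow> derivable E (subst \<sigma> s) (subst \<sigma> t)"
| refl: "derivable E t t"
| sym: "derivable E s t \<Longrightarrow> derivable E t s"
| trans: "derivable E s t \<Longrightarrow> derivable E t u \<Longrightarrow> derivable E s u"
| cong_neg: "derivable E s t \<Longrightarrow> derivable E (Neg s) (Neg t)"
| cong_and: "derivable E s1 t1 \<Longrightarrow> derivable E s2 t2 \<Longrightarrow> derivable E (LAnd s1 s2) (LAnd t1 t2)"
| cong_or: "derivable E s1 t1 \<Longrightarrow> derivable E s2 t2 \<Longrightarrow> derivable E (LOr s1 s2) (LOr t1 t2)"

abbreviation "vx \<equiv> Var 0"
abbreviation "vy \<equiv> Var 1"
abbreviation "vz \<equiv> Var 2"

definition F2 :: "'a sclterm \<times> 'a sclterm" where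
  "F2 = (LOr vx vy, Neg (LAnd (Neg vx) (Neg vy)))"
definition F4 :: "'a sclterm \<times> 'a sclterm" where
  "F4 = (LAnd Tr vx, vx)"
definition F5 :: "'a sclterm \<times> 'a sclterm" where
  "F5 = (LOr vx Fa, vx)"
definition F6 :: "'a sclterm \<times> 'a sclterm" where
  "F6 = (LAnd Fa vx, Fa)"
definition F7 :: "'a sclterm \<times> 'a sclterm" where
  "F7 = (LAnd (LAnd vx vy) vz, LAnd vx (LAnd vy vz))"
definition F8 :: "'a sclterm \<times> 'a sclterm" where
  "F8 = (LAnd (Neg vx) Fa, LAnd vx Fa)"
definition F9 :: "'a sclterm \<times> 'a sclterm" where
  "F9 = (LOr (LAnd vx Fa) vy, LAnd (LOr vx Tr) vy)"
definition F10 :: "'a sclterm \<times> 'a sclterm" where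
  "F10 = (LOr (LAnd vx vy) (LAnd vz Fa),
          LAnd (LOr vx (LAnd vz Fa)) (LOr vy (LAnd vz Fa)))"

definition EqFSCLm :: "('a sclterm \<times> 'a sclterm) set" where
  "EqFSCLm = {F2, F4, F5, F6, F7, F8, F9, F10}"

end

theory Submission
  imports Defs
begin

text \<open>
  Equational derivations are sound in every algebra, so each axiom is refuted by an algebra
  satisfying the other seven. The axioms contain no atoms and their variables range over the
  whole algebra, so the interpretation of the atoms is immaterial. Two-element algebras refute
  F2, F4, F5 and F6; in the remaining algebras negation swaps true and false, disjunction is
  given by F2, and two or three further elements, some of them left zeros of conjunction,
  break the axiom.
\<close>

section \<open>Algebras over the signature and soundness of derivations\<close>

record 'v scl_algebra =
  tru :: 'v
  fls :: 'v
  neg :: "'v \<Rightarrow> 'v"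
  land :: "'v \<Rightarrow> 'v \<Rightarrow> 'v"
  lor :: "'v \<Rightarrow> 'v \<Rightarrow> 'v"

primrec interp :: "'v scl_algebra \<Rightarrow> ('a \<Rightarrow> 'v) \<Rightarrow> (nat \<Rightarrow> 'v) \<Rightarrow> 'a sclterm \<Rightarrow> 'v" where
  "interp M \<alpha> \<rho> (Var n) = \<rho> n"
| "interp M \<alpha> \<rho> Tr = tru M"
| "interp M \<alpha> \<rho> Fa = fls M"
| "interp M \<alpha> \<rho> (Atom a) = \<alpha> a"
| "interp M \<alpha> \<rho> (Neg t) = neg M (interp M \<alpha> \<rho> t)"
| "interp M \<alpha> \<rho> (LAnd s t) = land M (interp M \<alpha> \<rho> s) (interp M \<alpha> \<rho> t)"
| "interp M \<alpha> \<rho> (LOr s t) = lor M (interp M \<alpha> \<rho> s) (interp M \<alpha> \<rho> t)"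

definition satisfies :: "'v scl_algebra \<Rightarrow> ('a \<Rightarrow> 'v) \<Rightarrow> 'a sclterm \<times> 'a sclterm \<Rightarrow> bool" where
  "satisfies M \<alpha> e \<longleftrightarrow> (\<forall>\<rho>. interp M \<alpha> \<rho> (fst e) = interp M \<alpha> \<rho> (snd e))"

text \<open>Carries truth from an axiom to its instances in the \<open>ax\<close> case of soundness:
  an axiom true under all valuations is true under the one that first applies the
  substitution.\<close>

lemma interp_subst: "interp M \<alpha> \<rho> (subst \<sigma> t) = interp M \<alpha> (\<lambda>n. interp M \<alpha> \<rho> (\<sigma> n)) t"
  by (induction t) simp_all

lemma derivable_sound:
  assumes "derivable E s t" and "\<And>e. e \<in> E \<Longrightarrow> satisfies M \<alpha> e"
  shows "interp M \<alpha> \<rho> s = interp M \<alpha> \<rho> t"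
  using assms(1)
proof (induction rule: derivable.induct)
  case (ax s t \<sigma>)
  then show ?case
    using assms(2)[of "(s, t)"] by (simp add: satisfies_def interp_subst)
qed simp_all

lemma not_derivableI:
  assumes "\<And>e'. e' \<in> E \<Longrightarrow> satisfies M \<alpha> e'" and "\<not> satisfies M \<alpha> e"
  shows "\<not> derivable E (fst e) (snd e)"
proof
  assume "derivable E (fst e) (snd e)"
  with assms(1) have "satisfies M \<alpha> e"
    unfolding satisfies_def[of _ _ e] by (blast intro: derivable_sound)
  with assms(2) show False ..
qed

text \<open>The axioms mention only variables 0, 1 and 2, so quantifying over valuations reduces to
  quantifying over elements, which a finite algebra settles by cases.\<close>

lemma all_valuations_3:
  "(\<forall>\<rho> :: nat \<Rightarrow> 'v. P (\<rho> 0) (\<rho> 1) (\<rho> 2)) \<longleftrightarrow> (\<forall>x y z. P x y z)"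
proof
  assume *: "\<forall>\<rho> :: nat \<Rightarrow> 'v. P (\<rho> 0) (\<rho> 1) (\<rho> 2)"
  show "\<forall>x y z. P x y z"
  proof (intro allI)
    fix x y z
    show "P x y z"
      using *[rule_format, of "(\<lambda>_. z)(0 := x, 1 := y)"] by simp
  qed
qed simp

lemma satisfies_axiom_iffs:
  "satisfies M \<alpha> F2 \<longleftrightarrow> (\<forall>x y. lor M x y = neg M (land M (neg M x) (neg M y)))"
  "satisfies M \<alpha> F4 \<longleftrightarrow> (\<forall>x. land M (tru M) x = x)"
  "satisfies M \<alpha> F5 \<longleftrightarrow> (\<forall>x. lor M x (fls M) = x)"
  "satisfies M \<alpha> F6 \<longleftrightarrow> (\<forall>x. land M (fls M) x = fls M)"
  "satisfies M \<alpha> F7 \<longleftrightarrow> (\<forall>x y z. land M (land M x y) z = land M x (land M y z))"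
  "satisfies M \<alpha> F8 \<longleftrightarrow> (\<forall>x. land M (neg M x) (fls M) = land M x (fls M))"
  "satisfies M \<alpha> F9 \<longleftrightarrow>
    (\<forall>x y. lor M (land M x (fls M)) y = land M (lor M x (tru M)) y)"
  "satisfies M \<alpha> F10 \<longleftrightarrow>
    (\<forall>x y z. lor M (land M x y) (land M z (fls M)) =
      land M (lor M x (land M z (fls M))) (lor M y (land M z (fls M))))"
  unfolding satisfies_def F2_def F4_def F5_def F6_def F7_def F8_def F9_def F10_def
  subgoal
    using all_valuations_3[of "\<lambda>x y z. lor M x y = neg M (land M (neg M x) (neg M y))"]
    by simp
  subgoal
    using all_valuations_3[of "\<lambda>x y z. land M (tru M) x = x"]
    by simp
  subgoal
    using all_valuations_3[of "\<lambda>x y z. lor M x (fls M) = x"]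
    by simp
  subgoal
    using all_valuations_3[of "\<lambda>x y z. land M (fls M) x = fls M"]
    by simp
  subgoal
    using all_valuations_3[of "\<lambda>x y z. land M (land M x y) z = land M x (land M y z)"]
    by simp
  subgoal
    using all_valuations_3[of "\<lambda>x y z. land M (neg M x) (fls M) = land M x (fls M)"]
    by simp
  subgoal
    using all_valuations_3[of "\<lambda>x y z. lor M (land M x (fls M)) y = land M (lor M x (tru M)) y"]
    by simp
  subgoal
    using all_valuations_3[of "\<lambda>x y z.
      lor M (land M x y) (land M z (fls M)) =
        land M (lor M x (land M z (fls M))) (lor M y (land M z (fls M)))"]
    by simp
  done

section \<open>The refuting algebras\<close>

definition identity_negation :: "bool scl_algebra" where
  "identity_negation = \<lparr>tru = True, fls = False, neg = id, land = (\<and>), lor = (\<or>)\<rparr>"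

text \<open>Every term takes the value of its leftmost leaf, and F4 is the only axiom whose sides
  have different leftmost leaves.\<close>

definition left_projection :: "bool scl_algebra" where
  "left_projection =
    \<lparr>tru = False, fls = False, neg = id, land = (\<lambda>x y. x), lor = (\<lambda>x y. x)\<rparr>"

text \<open>Negation is constant as well, so that both sides of F2, F9 and F10 collapse to
  \<open>False\<close>.\<close>

definition constant_disjunction :: "bool scl_algebra" where
  "constant_disjunction =
    \<lparr>tru = True, fls = False, neg = (\<lambda>_. False), land = (\<and>), lor = (\<lambda>x y. False)\<rparr>"

text \<open>F4 and F5 become unit laws and F9 and F10 semilattice identities, whereas F6 would make
  the unit a zero.\<close>

definition meet_monoid :: "bool scl_algebra" where
  "meet_monoid = \<lparr>tru = True, fls = True, neg = id, land = (\<and>), lor = (\<and>)\<rparr>"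

text \<open>F2 holds by construction. When \<open>n\<close> is an involution exchanging
  \<open>t\<close> and \<open>f\<close>, as in all uses below, F5 says that \<open>t\<close> is a
  right unit of \<open>c\<close>.\<close>

definition de_morgan_algebra ::
  "'v \<Rightarrow> 'v \<Rightarrow> ('v \<Rightarrow> 'v) \<Rightarrow> ('v \<Rightarrow> 'v \<Rightarrow> 'v) \<Rightarrow> 'v scl_algebra" where
  "de_morgan_algebra t f n c =
    \<lparr>tru = t, fls = f, neg = n, land = c, lor = (\<lambda>x y. n (c (n x) (n y)))\<rparr>"

text \<open>\<open>Uv\<close> is a left zero of both conjunctions below and, being its own negation,
  of the induced disjunctions. \<open>Mv\<close> is the element that breaks the axiom.\<close>

datatype val4 = Tv | Fv | Uv | Mv

lemma all_val4: "(\<forall>x. P x) \<longleftrightarrow> P Tv \<and> P Fv \<and> P Uv \<and> P Mv"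
  by (metis val4.exhaust)

fun neg4 :: "val4 \<Rightarrow> val4" where
  "neg4 Tv = Fv"
| "neg4 Fv = Tv"
| "neg4 x = x"

text \<open>F10 survives because disjunction with \<open>Uv\<close> on the right fixes
  \<open>Tv\<close> and sends all else to \<open>Uv\<close>, while a conjunction is
  \<open>Tv\<close> only if both arguments are. The other value of a conjunction with
  \<open>Fv\<close> on the right is \<open>Fv\<close>, where F10 follows from F5.\<close>

fun nonassoc_and :: "val4 \<Rightarrow> val4 \<Rightarrow> val4" where
  "nonassoc_and Tv y = y"
| "nonassoc_and Fv y = Fv"
| "nonassoc_and Uv y = Uv"
| "nonassoc_and Mv Tv = Mv"
| "nonassoc_and Mv Fv = Uv"
| "nonassoc_and Mv Uv = Uv"
| "nonassoc_and Mv Mv = Fv"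

fun nilpotent_and :: "val4 \<Rightarrow> val4 \<Rightarrow> val4" where
  "nilpotent_and Tv y = y"
| "nilpotent_and Fv y = Fv"
| "nilpotent_and Uv y = Uv"
| "nilpotent_and Mv y = (if y = Tv then Mv else Fv)"

text \<open>Short-circuit Booleans with two left zeros added. Negation exchanges the left zeros, and
  conjunction with false does not merge them, so F8 fails there.\<close>

fun left_zero_and :: "bool + bool \<Rightarrow> bool + bool \<Rightarrow> bool + bool" where
  "left_zero_and (Inl b) y = (if b then y else Inl False)"
| "left_zero_and (Inr b) y = Inr b"

lemma all_bool_sum:
  "(\<forall>x :: bool + bool. P x) \<longleftrightarrow>
    P (Inl True) \<and> P (Inl False) \<and> P (Inr True) \<and> P (Inr False)"
  by (metis (full_types) sum.exhaust)

datatype val5 = Tw | Fw | Pw | Qw | Mw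

lemma all_val5: "(\<forall>x. P x) \<longleftrightarrow> P Tw \<and> P Fw \<and> P Pw \<and> P Qw \<and> P Mw"
  by (metis val5.exhaust)

fun neg5 :: "val5 \<Rightarrow> val5" where
  "neg5 Tw = Fw"
| "neg5 Fw = Tw"
| "neg5 Pw = Qw"
| "neg5 Qw = Pw"
| "neg5 Mw = Mw"

text \<open>\<open>Pw\<close> and \<open>Qw\<close> behave as false and true reached after a side
  effect. \<open>Mw\<close> is self-dual: conjunction after \<open>Qw\<close> treats it as false, so
  disjunction after \<open>Pw\<close> treats it as true.\<close>

fun and5 :: "val5 \<Rightarrow> val5 \<Rightarrow> val5" where
  "and5 Tw y = y"
| "and5 Fw y = Fw"
| "and5 Pw y = Pw"
| "and5 x Tw = x"
| "and5 x Qw = x"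
| "and5 x y = Pw"

section \<open>Independence, one axiom at a time\<close>

lemma F2_independent:
  "\<not> derivable (EqFSCLm - {F2}) (fst F2) (snd F2 :: 'a sclterm)"
proof (rule not_derivableI)
  let ?M = "identity_negation"
  let ?\<alpha> = "\<lambda>_ :: 'a. fls ?M"
  show "satisfies ?M ?\<alpha> e" if "e \<in> EqFSCLm - {F2}" for e
    using that by (auto simp: EqFSCLm_def satisfies_axiom_iffs identity_negation_def)
  \<comment> \<open>With negation the identity, F2 would equate disjunction and conjunction.\<close>
  show "\<not> satisfies ?M ?\<alpha> F2"
    by (auto simp: satisfies_axiom_iffs identity_negation_def)
qed

lemma F4_independent:
  "\<not> derivable (EqFSCLm - {F4}) (fst F4) (snd F4 :: 'a sclterm)"
proof (rule not_derivableI)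
  let ?M = "left_projection"
  let ?\<alpha> = "\<lambda>_ :: 'a. fls ?M"
  show "satisfies ?M ?\<alpha> e" if "e \<in> EqFSCLm - {F4}" for e
    using that by (auto simp: EqFSCLm_def satisfies_axiom_iffs left_projection_def)
  show "\<not> satisfies ?M ?\<alpha> F4"
    by (auto simp: satisfies_axiom_iffs left_projection_def)
qed

lemma F5_independent:
  "\<not> derivable (EqFSCLm - {F5}) (fst F5) (snd F5 :: 'a sclterm)"
proof (rule not_derivableI)
  let ?M = "constant_disjunction"
  let ?\<alpha> = "\<lambda>_ :: 'a. fls ?M"
  show "satisfies ?M ?\<alpha> e" if "e \<in> EqFSCLm - {F5}" for e
    using that by (auto simp: EqFSCLm_def satisfies_axiom_iffs constant_disjunction_def)
  show "\<not> satisfies ?M ?\<alpha> F5"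
    by (auto simp: satisfies_axiom_iffs constant_disjunction_def)
qed

lemma F6_independent:
  "\<not> derivable (EqFSCLm - {F6}) (fst F6) (snd F6 :: 'a sclterm)"
proof (rule not_derivableI)
  let ?M = "meet_monoid"
  let ?\<alpha> = "\<lambda>_ :: 'a. fls ?M"
  show "satisfies ?M ?\<alpha> e" if "e \<in> EqFSCLm - {F6}" for e
    using that by (auto simp: EqFSCLm_def satisfies_axiom_iffs meet_monoid_def)
  show "\<not> satisfies ?M ?\<alpha> F6"
    by (auto simp: satisfies_axiom_iffs meet_monoid_def)
qed

lemma F7_independent:
  "\<not> derivable (EqFSCLm - {F7}) (fst F7) (snd F7 :: 'a sclterm)"
proof (rule not_derivableI)
  let ?M = "de_morgan_algebra Tv Fv neg4 nonassoc_and"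
  let ?\<alpha> = "\<lambda>_ :: 'a. fls ?M"
  show "satisfies ?M ?\<alpha> e" if "e \<in> EqFSCLm - {F7}" for e
    using that by (auto simp: EqFSCLm_def satisfies_axiom_iffs de_morgan_algebra_def all_val4)
  \<comment> \<open>Fails at \<open>Mv\<close>, \<open>Mv\<close>, \<open>Fv\<close>: grouping to
    the left gives \<open>Fv\<close>, to the right \<open>Uv\<close>.\<close>
  show "\<not> satisfies ?M ?\<alpha> F7"
    by (auto simp: satisfies_axiom_iffs de_morgan_algebra_def all_val4)
qed

lemma F8_independent:
  "\<not> derivable (EqFSCLm - {F8}) (fst F8) (snd F8 :: 'a sclterm)"
proof (rule not_derivableI)
  let ?M = "de_morgan_algebra (Inl True) (Inl False) (map_sum Not Not) left_zero_and"
  let ?\<alpha> = "\<lambda>_ :: 'a. fls ?M"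
  show "satisfies ?M ?\<alpha> e" if "e \<in> EqFSCLm - {F8}" for e
    using that by (auto simp: EqFSCLm_def satisfies_axiom_iffs de_morgan_algebra_def all_bool_sum)
  show "\<not> satisfies ?M ?\<alpha> F8"
    by (auto simp: satisfies_axiom_iffs de_morgan_algebra_def all_bool_sum)
qed

lemma F9_independent:
  "\<not> derivable (EqFSCLm - {F9}) (fst F9) (snd F9 :: 'a sclterm)"
proof (rule not_derivableI)
  let ?M = "de_morgan_algebra Tw Fw neg5 and5"
  let ?\<alpha> = "\<lambda>_ :: 'a. fls ?M"
  show "satisfies ?M ?\<alpha> e" if "e \<in> EqFSCLm - {F9}" for e
    using that by (auto simp: EqFSCLm_def satisfies_axiom_iffs de_morgan_algebra_def all_val5)
  \<comment> \<open>Fails at \<open>x = Pw\<close>, \<open>y = Mw\<close>: the left side is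
    \<open>Qw\<close>, the right side \<open>Pw\<close>.\<close>
  show "\<not> satisfies ?M ?\<alpha> F9"
    by (auto simp: satisfies_axiom_iffs de_morgan_algebra_def all_val5)
qed

lemma F10_independent:
  "\<not> derivable (EqFSCLm - {F10}) (fst F10) (snd F10 :: 'a sclterm)"
proof (rule not_derivableI)
  let ?M = "de_morgan_algebra Tv Fv neg4 nilpotent_and"
  let ?\<alpha> = "\<lambda>_ :: 'a. fls ?M"
  show "satisfies ?M ?\<alpha> e" if "e \<in> EqFSCLm - {F10}" for e
    using that by (auto simp: EqFSCLm_def satisfies_axiom_iffs de_morgan_algebra_def all_val4)
  \<comment> \<open>Fails at \<open>x = y = Mv\<close>, \<open>z = Uv\<close>: the conjunction of
    \<open>Mv\<close> with itself is \<open>Fv\<close>, so the left side is \<open>Uv\<close>, but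
    \<open>Mv\<close> or \<open>Uv\<close> is \<open>Tv\<close>, so the right side is
    \<open>Tv\<close>.\<close>
  show "\<not> satisfies ?M ?\<alpha> F10"
    by (auto simp: satisfies_axiom_iffs de_morgan_algebra_def all_val4)
qed

theorem theorem2p8:
  fixes a b :: 'a
  assumes "a \<noteq> b"
  shows "\<forall>e \<in> (EqFSCLm :: ('a sclterm \<times> 'a sclterm) set).
           \<not> derivable (EqFSCLm - {e}) (fst e) (snd e)"
  using F2_independent F4_independent F5_independent F6_independent
    F7_independent F8_independent F9_independent F10_independent
  unfolding EqFSCLm_def by blast

end
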